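(* For every integer $r\ge 3$ we have $f(r,2)\ge r(r+5)-12$.
   Context: A permutation is any finite sequence of distinct integers. Two permutations $(x_1,\dots,x_k)$ and $(y_1,\dots,y_k)$ of the same length are similar if $x_i<x_j$ if and only if $y_i<y_j$ for all $1\le i<j\le k$. For an integer $r\ge 2$, a collection of $r$ pairwise disjoint (occupying pairwise disjoint sets of positions), pairwise similar subsequences of a permutation $\pi$, each of length $k$, forms tight $r$-twins of length $k$ in $\pi$ if the union of the positions they occupy is a segment of consecutive positions of $\pi$ (of length $rk$). For integers $r,k\ge2$, $f(r,k)$ is the minimum $n$ such that every permutation of length $n$ contains tight $r$-twins of length exactly $k$; if no such $n$ exists, $f(r,k)=\infty$. *)

theory Defs
  imports Main "HOL-Library.Extended_Nat"
begin

definition is_permutation :: "int list \<Rightarrow> bool" where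
  "is_permutation xs \<longleftrightarrow> distinct xs"

definition similar :: "int list \<Rightarrow> int list \<Rightarrow> bool" where
  "similar xs ys \<longleftrightarrow> length xs = length ys \<and>
     (\<forall>i j. i < j \<and> j < length xs \<longrightarrow> (xs ! i < xs ! j \<longleftrightarrow> ys ! i < ys ! j))"

text \<open>A subsequence of \<open>xs\<close> is represented by the set \<open>P\<close> of (0-based) positions it occupies;
  the subsequence itself is \<open>nths xs P\<close>. The collection of twins is the set \<open>\<P>\<close> of these
  position sets.\<close>

definition tight_twins :: "nat \<Rightarrow> nat \<Rightarrow> int list \<Rightarrow> nat set set \<Rightarrow> bool" where
  "tight_twins r k xs \<P> \<longleftrightarrow>
     finite \<P> \<and> card \<P> = r \<and>
     (\<forall>P\<in>\<P>. P \<subseteq> {..<length xs} \<and> card P = k) \<and>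
     pairwise disjnt \<P> \<and>
     pairwise (\<lambda>P Q. similar (nths xs P) (nths xs Q)) \<P> \<and>
     (\<exists>s. s + r * k \<le> length xs \<and> \<Union>\<P> = {s..<s + r * k})"

text \<open>The infimum in \<open>enat\<close> is the minimum of a nonempty set of natural numbers, and \<open>\<infinity>\<close> for
  the empty set.\<close>

definition f :: "nat \<Rightarrow> nat \<Rightarrow> enat" where
  "f r k = Inf (enat ` {n. \<forall>xs. is_permutation xs \<and> length xs = n \<longrightarrow>
     (\<exists>\<P>. tight_twins r k xs \<P>)})"

end

theory Submission
  imports Defs
begin

text \<open>
  Tight \<open>r\<close>-twins of length 2 are a window of \<open>2r\<close> consecutive positions split into \<open>r\<close> pairs
  that are all increasing or all decreasing. The lower bound comes from a permutation of length
  \<open>r(r+5)-13\<close> in which no window splits in this way; its prefixes serve all shorter lengths.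

  Number the positions by the integers \<open>p\<close> with \<open>\<bar>p\<bar> \<le> M\<close>, where
  \<open>2M+1 = r(r+5)-13\<close>, and put the value \<open>e(\<bar>p\<bar>) \<cdot> p\<close> at \<open>p\<close> for a suitable sign sequence \<open>e\<close>.
  Whether two positions form an increasing pair is then decided by the one further from the origin:
  they do if and only if its sign is \<open>+1\<close> (\<open>entry_less_iff\<close>). Suppose a window is split into
  increasing pairs, and discard all positions with \<open>\<bar>p\<bar> < t\<close>. Each pair loses its inner element
  first, so what is left of it has a nonnegative sum of signs, and hence so has the rest of the window
  (\<open>sum_outer_nonneg\<close>). In the same way, a window split into decreasing pairs has only nonpositive
  such sums. It therefore suffices to choose \<open>e\<close> so that, for every window, these outer sums take
  both a positive and a negative value as \<open>t\<close> varies (\<open>window_changes_sign\<close>).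

  The sequence \<open>e\<close> has constant runs of lengths \<open>r, r-1, \<dots>, 2, 1\<close> with alternating signs,
  followed by \<open>2r-6\<close> further runs of length 1. Read inwards from the outer end of a window that lies
  on one side of the origin, the partial sums of \<open>e\<close> form a walk. Inside a run the first step
  already gives one of the two signs, and because the next run inwards is longer by one, it carries the
  walk past its starting level and gives the other sign within \<open>2r\<close> steps
  (\<open>walk_changes_sign\<close>). The outermost alternating part adds little to the walk, so from there the
  runs of lengths 1, 2 and 3 are still reached in time; the length \<open>2r-6\<close> is exactly what this
  leaves room for. A window around the origin contains more than half of the central block of \<open>2r-1\<close>
  positive signs, while its outermost sign is negative.
\<close>

section \<open>Pairs dominated by their outer elements\<close>

text \<open>
  Each pair meets the region \<open>t \<le> \<bar>p\<bar>\<close> in nothing, in its outer element alone, or in both elements,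
  and the sign \<open>1\<close> of the outer element makes up for a negative sign of the inner one.
\<close>

lemma sum_outer_nonneg:
  fixes sgn_of :: "int \<Rightarrow> int"
  assumes fin: "finite \<P>" and disj: "pairwise disjnt \<P>"
    and pairs: "\<And>P. P \<in> \<P> \<Longrightarrow> \<exists>p q. P = {p, q} \<and> p \<noteq> q \<and> \<bar>q\<bar> \<le> \<bar>p\<bar> \<and> sgn_of p = 1
                  \<and> sgn_of q \<ge> -1"
  shows "0 \<le> (\<Sum>p\<in>{p \<in> \<Union>\<P>. t \<le> \<bar>p\<bar>}. sgn_of p)"
proof -
  define A where "A P = {p \<in> P. t \<le> \<bar>p\<bar>}" for P :: "int set"
  have A_nonneg: "0 \<le> sum sgn_of (A P)" if "P \<in> \<P>" for P
  proof -
    from pairs[OF that] obtain p q where P: "P = {p, q}"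
      and pq: "p \<noteq> q" "\<bar>q\<bar> \<le> \<bar>p\<bar>" "sgn_of p = 1" "sgn_of q \<ge> -1"
      by blast
    have "A P = {} \<or> A P = {p} \<or> A P = {p, q}"
      using pq(2) unfolding A_def P by auto
    then show ?thesis
      using pq by auto
  qed
  have fin_P: "finite P" if "P \<in> \<P>" for P
    using pairs[OF that] by auto
  have "{p \<in> \<Union>\<P>. t \<le> \<bar>p\<bar>} = (\<Union>P\<in>\<P>. A P)"
    unfolding A_def by auto
  also have "sum sgn_of \<dots> = (\<Sum>P\<in>\<P>. sum sgn_of (A P))"
  proof (rule sum.UNION_disjoint[OF fin])
    show "\<forall>P\<in>\<P>. finite (A P)"
      using fin_P unfolding A_def by simp
    show "\<forall>P\<in>\<P>. \<forall>Q\<in>\<P>. P \<noteq> Q \<longrightarrow> A P \<inter> A Q = {}"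
      using disj unfolding A_def pairwise_def disjnt_def by blast
  qed
  also have "0 \<le> \<dots>"
    by (rule sum_nonneg) (rule A_nonneg)
  finally show ?thesis .
qed

section \<open>The sign sequence\<close>

definition run_length :: "nat \<Rightarrow> nat \<Rightarrow> nat" where
  "run_length r j = (if j < r then r - j else 1)"

text \<open>The partial sums of the run lengths: run \<open>j\<close> occupies the numbers from \<open>run_start r j\<close>
  to \<open>run_start r (Suc j) - 1\<close>.\<close>

definition run_start :: "nat \<Rightarrow> nat \<Rightarrow> nat" where
  "run_start r j = (\<Sum>i<j. run_length r i)"

text \<open>The exponent is the index of the run that contains \<open>n\<close>.\<close>

definition run_sign :: "nat \<Rightarrow> nat \<Rightarrow> int" where
  "run_sign r n = (- 1) ^ (LEAST j. n < run_start r (Suc j))"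

text \<open>The last number in the first \<open>r + (2r-6)\<close> runs: the first \<open>r\<close> of them have total length
  \<open>r(r+1)/2\<close>, the others have length 1, and numbering starts at 0.\<close>

definition radius :: "nat \<Rightarrow> nat" where
  "radius r = r * (r + 1) div 2 + 2 * r - 7"

lemma run_length_pos: "0 < run_length r j"
  by (simp add: run_length_def)

lemma run_start_0 [simp]: "run_start r 0 = 0"
  by (simp add: run_start_def)

lemma run_start_Suc: "run_start r (Suc j) = run_start r j + run_length r j"
  by (simp add: run_start_def)

lemma strict_mono_run_start: "strict_mono (run_start r)"
  by (simp add: strict_mono_Suc_iff run_start_Suc run_length_pos)

lemma run_sign_cases: "run_sign r n = 1 \<or> run_sign r n = - 1"
  unfolding run_sign_def by (metis neg_one_even_power neg_one_odd_power)

lemma run_sign_in_run: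
  assumes "run_start r j \<le> n" "n < run_start r (Suc j)"
  shows "run_sign r n = (- 1) ^ j"
proof -
  have "(LEAST j. n < run_start r (Suc j)) = j"
  proof (rule Least_equality)
    fix k assume "n < run_start r (Suc k)"
    with assms(1) have "run_start r j < run_start r (Suc k)" by simp
    then show "j \<le> k"
      using strict_mono_less[OF strict_mono_run_start] by auto
  qed (rule assms(2))
  then show ?thesis by (simp add: run_sign_def)
qed

text \<open>The remainder \<open>d\<close> is positive, so that \<open>j\<close> is the run of \<open>m - 1\<close>, the first number met
  when a walk goes inwards from the boundary \<open>m\<close>.\<close>

lemma run_decomposition:
  assumes "0 < m"
  obtains j d where "m = run_start r j + d" "0 < d" "d \<le> run_length r j"
proof -
  have "m \<le> run_start r m"
    using strict_mono_imp_increasing[OF strict_mono_run_start] .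
  define k where "k = (LEAST k. m \<le> run_start r k)"
  have k: "m \<le> run_start r k"
    unfolding k_def using \<open>m \<le> run_start r m\<close> by (rule LeastI)
  with \<open>0 < m\<close> obtain j where j: "k = Suc j" by (cases k) auto
  have "run_start r j < m"
    using not_less_Least[of j "\<lambda>k. m \<le> run_start r k"] j k_def by simp
  with k show thesis
    by (intro that[of j "m - run_start r j"]) (auto simp: j run_start_Suc)
qed

lemma sum_run_sign_const:
  assumes "run_start r j \<le> l" "l \<le> u" "u \<le> run_start r (Suc j)"
  shows "sum (run_sign r) {l..<u} = (- 1) ^ j * int (u - l)"
proof -
  have "sum (run_sign r) {l..<u} = (\<Sum>n\<in>{l..<u}. (- 1) ^ j)"
    by (rule sum.cong) (use assms in \<open>auto intro: run_sign_in_run\<close>)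
  then show ?thesis by simp
qed

text \<open>The closed form \<open>run_start r j = j(2r+1-j)/2\<close>, arranged to avoid subtraction and division.\<close>

lemma twice_run_start_plus_square: "j \<le> r \<Longrightarrow> 2 * run_start r j + j * j = j * (2 * r + 1)"
proof (induction j)
  case (Suc j)
  then show ?case
    by (simp add: run_start_Suc run_length_def algebra_simps)
qed simp

lemma run_start_ge: "run_start r (r + i) = run_start r r + i"
  by (induction i) (simp_all add: run_start_Suc run_length_def)

lemma sum_run_sign_ones:
  "sum (run_sign r) {run_start r r..<run_start r r + i} = (if odd i then (- 1) ^ r else 0)"
proof (induction i)
  case (Suc i)
  have "run_sign r (run_start r r + i) = (- 1) ^ (r + i)"
    using run_start_ge[of r i] run_start_ge[of r "Suc i"] by (intro run_sign_in_run) auto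
  with Suc show ?case by (auto simp: power_add)
qed simp

text \<open>
  Going inwards from \<open>m\<close>, the sum after one step is the sign \<open>(- 1) ^ j\<close> of the run \<open>j\<close> that
  contains \<open>m - 1\<close>; the point is to reach the opposite sign within \<open>2r\<close> steps. If run \<open>j\<close>
  is left after \<open>d\<close> steps, then \<open>d + 1\<close> steps in the next run inwards, which has the opposite sign,
  do this; for \<open>0 < j < r\<close> that run is long enough, and \<open>r < m\<close> excludes \<open>j = 0\<close>. Among the alternating runs
  of length 1 the way to the first \<open>r\<close> runs is longer, but it contributes at most one unit. From there,
  the runs of lengths 1 and 2 suffice if this contribution is 0, and the run of length 3 is needed as
  well if it is not.
\<close>

lemma walk_changes_sign:
  assumes "3 \<le> r" "r < m" "m \<le> radius r + 1" and \<tau>: "\<tau> = 1 \<or> \<tau> = (- 1 :: int)"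
  shows "\<exists>t < m. m \<le> t + 2 * r \<and> \<tau> * sum (run_sign r) {t..<m} < 0"
proof -
  have radius: "radius r + 1 = run_start r r + 2 * r - 6"
    using twice_run_start_plus_square[of r r] assms(1) by (simp add: radius_def algebra_simps)
  obtain j d where m: "m = run_start r j + d" and d: "0 < d" "d \<le> run_length r j"
    using run_decomposition[of m r] assms(2) by auto
  have "j \<noteq> 0"
    using m d assms(1,2) by (intro notI) (simp add: run_length_def)
  have last: "sum (run_sign r) {m - 1..<m} = (- 1) ^ j"
    using sum_run_sign_const[of r j "m - 1" m] m d by (simp add: run_start_Suc)
  have "\<exists>t < m. m \<le> t + 2 * r \<and> (- 1) ^ j * sum (run_sign r) {t..<m} < 0"
  proof (cases "j < r")
    case True
    obtain i where i: "j = Suc i" using \<open>j \<noteq> 0\<close> by (cases j) auto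
    \<comment> \<open>\<open>d\<close> steps through run \<open>j\<close>, then one more than that against it\<close>
    define t where "t = run_start r j - (d + 1)"
    have len: "d + 1 \<le> run_length r i" "d + 1 \<le> r"
      using True d by (auto simp: i run_length_def)
    then have t: "run_start r i \<le> t" "t + (d + 1) = run_start r j"
      by (auto simp: t_def i run_start_Suc)
    have "sum (run_sign r) {t..<m}
            = sum (run_sign r) {t..<run_start r j} + sum (run_sign r) {run_start r j..<m}"
      using t m by (simp add: sum.atLeastLessThan_concat)
    also have "sum (run_sign r) {t..<run_start r j} = (- 1) ^ i * int (d + 1)"
      using sum_run_sign_const[of r i t "run_start r j"] t by (simp add: i)
    also have "sum (run_sign r) {run_start r j..<m} = (- 1) ^ j * int d"
      using sum_run_sign_const[of r j "run_start r j" m] m d by (simp add: run_start_Suc)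
    finally have "(- 1) ^ j * sum (run_sign r) {t..<m} = - 1"
      by (cases "even i") (simp_all add: i)
    then show ?thesis
      using t m len by (intro exI[of _ t]) auto
  next
    case False
    then obtain k where k: "j = r + k" using le_Suc_ex not_less by blast
    have d1: "d = 1" using d k by (simp add: run_length_def)
    have m': "m = run_start r r + Suc k"
      using m d1 by (simp add: k run_start_ge)
    have k_le: "Suc k + 6 \<le> 2 * r"
      using assms(1,3) m' radius by simp
    \<comment> \<open>the runs \<open>q\<close>, \<open>q + 1\<close> and \<open>q + 2\<close> are those of lengths 3, 2 and 1\<close>
    obtain q where q: "r = Suc (Suc (Suc q))"
      using assms(1) that[of "r - 3"] by simp
    have starts: "run_start r (Suc q) = run_start r q + 3" 
        "run_start r (Suc (Suc q)) = run_start r q + 5"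
        "run_start r r = run_start r q + 6"
      by (simp_all add: q run_start_Suc run_length_def)
    have s0: "sum (run_sign r) {run_start r q..<run_start r (Suc q)} = (- 1) ^ q * 3"
      using sum_run_sign_const[of r q "run_start r q" "run_start r (Suc q)"] starts by simp
    have s1: "sum (run_sign r) {run_start r (Suc q)..<run_start r (Suc (Suc q))} = (- 1) ^ Suc q * 2"
      using sum_run_sign_const[of r "Suc q" "run_start r (Suc q)" "run_start r (Suc (Suc q))"] starts
      by simp
    have s2: "sum (run_sign r) {run_start r (Suc (Suc q))..<run_start r r} = (- 1) ^ q"
      using sum_run_sign_const[of r "Suc (Suc q)" "run_start r (Suc (Suc q))" "run_start r r"] starts q
      by simp
    have s3: "sum (run_sign r) {run_start r r..<m} = (if even k then (- 1) ^ r else 0)"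
      using sum_run_sign_ones[of r "Suc k"] m' by simp
    have t1: "sum (run_sign r) {run_start r (Suc q)..<m} = - ((- 1) ^ q) + (if even k then (- 1) ^ r else 0)"
      using s1 s2 s3 starts m'
        sum.atLeastLessThan_concat[of "run_start r (Suc q)" "run_start r (Suc (Suc q))" "run_start r r" "run_sign r"]
        sum.atLeastLessThan_concat[of "run_start r (Suc q)" "run_start r r" m "run_sign r"]
      by simp
    have t0: "sum (run_sign r) {run_start r q..<m} = (- 1) ^ q * 2 + (if even k then (- 1) ^ r else 0)"
      using s0 t1 starts m'
        sum.atLeastLessThan_concat[of "run_start r q" "run_start r (Suc q)" m "run_sign r"]
      by simp
    have "(- 1 :: int) ^ r = - ((- 1) ^ q)" by (simp add: q)
    note signs = k power_add this
    show ?thesis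
    proof (cases "even k")
      case True
      then have "(- 1) ^ j * sum (run_sign r) {run_start r q..<m} = - 1"
        by (cases "even q") (simp_all add: t0 signs)
      then show ?thesis
        using k_le starts m' by (intro exI[of _ "run_start r q"]) auto
    next
      case False
      then have "(- 1) ^ j * sum (run_sign r) {run_start r (Suc q)..<m} = - 1"
        by (cases "even q") (simp_all add: t1 signs)
      then show ?thesis
        using k_le starts m' by (intro exI[of _ "run_start r (Suc q)"]) auto
    qed
  qed
  moreover have "\<exists>t < m. m \<le> t + 2 * r \<and> - ((- 1) ^ j) * sum (run_sign r) {t..<m} < 0"
    using last assms(1,2) by (intro exI[of _ "m - 1"]) (cases "even j"; simp)
  moreover have "\<tau> = (- 1) ^ j \<or> \<tau> = - ((- 1) ^ j)"
    using \<tau> by (cases "even j") auto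
  ultimately show ?thesis by blast
qed

text \<open>
  A window \<open>{a..b}\<close> in the nonnegative integers is an instance of the walk from \<open>m = b + 1\<close>. If
  \<open>a < 0\<close>, then \<open>r \<le> b \<le> 2r - 2\<close>, so \<open>b\<close> lies in the second run, which is negative, and \<open>-a\<close>
  in the first. Hence the element \<open>b\<close> alone gives a negative outer sum. In the whole window the
  positive signs prevail, because at most \<open>r - 1\<close> of its \<open>2r\<close> elements lie in the second run.
\<close>

lemma window_changes_sign_nearer_right:
  assumes r: "3 \<le> r" and b: "b = a + 2 * int r - 1" "- a \<le> b" "b \<le> int (radius r)"
    and \<tau>: "\<tau> = 1 \<or> \<tau> = (- 1 :: int)"
  shows "\<exists>t. \<tau> * (\<Sum>p\<in>{p \<in> {a..b}. t \<le> \<bar>p\<bar>}. run_sign r (nat \<bar>p\<bar>)) < 0"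
proof (cases "0 \<le> a")
  case True
  define m where "m = nat (b + 1)"
  have "r < m" "m \<le> radius r + 1"
    using True b r by (auto simp: m_def)
  then obtain t where t: "t < m" "m \<le> t + 2 * r" "\<tau> * sum (run_sign r) {t..<m} < 0"
    using walk_changes_sign[OF r _ _ \<tau>] by blast
  have "{p \<in> {a..b}. int t \<le> \<bar>p\<bar>} = int ` {t..<m}"
    using True b t by (auto simp: m_def image_int_atLeastLessThan)
  then have "(\<Sum>p\<in>{p \<in> {a..b}. int t \<le> \<bar>p\<bar>}. run_sign r (nat \<bar>p\<bar>)) = sum (run_sign r) {t..<m}"
    by (simp add: sum.reindex)
  with t(3) show ?thesis by metis
next
  case False
  have inner: "run_sign r (nat \<bar>p\<bar>) = 1" if "\<bar>p\<bar> < int r" for p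
    using run_sign_in_run[of r 0 "nat \<bar>p\<bar>"] that r by (simp add: run_start_Suc run_length_def)
  have outer: "run_sign r (nat \<bar>p\<bar>) = - 1" if "int r \<le> p" "p \<le> b" for p
    using run_sign_in_run[of r 1 "nat \<bar>p\<bar>"] that False b r
    by (simp add: run_start_Suc run_length_def)
  have "- a < b"
    using b by presburger
  then have "{p \<in> {a..b}. b \<le> \<bar>p\<bar>} = {b}"
    using False by auto
  then have neg: "(\<Sum>p\<in>{p \<in> {a..b}. b \<le> \<bar>p\<bar>}. run_sign r (nat \<bar>p\<bar>)) < 0"
    using outer[of b] b by simp
  \<comment> \<open>threshold 0 discards nothing\<close>
  have "{p \<in> {a..b}. 0 \<le> \<bar>p\<bar>} = {a..<int r} \<union> {int r..b}"
    using False b by auto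
  then have "(\<Sum>p\<in>{p \<in> {a..b}. 0 \<le> \<bar>p\<bar>}. run_sign r (nat \<bar>p\<bar>))
      = (\<Sum>p\<in>{a..<int r}. run_sign r (nat \<bar>p\<bar>)) + (\<Sum>p\<in>{int r..b}. run_sign r (nat \<bar>p\<bar>))"
    by (simp add: sum.union_disjoint ivl_disj_int)
  also have "(\<Sum>p\<in>{a..<int r}. run_sign r (nat \<bar>p\<bar>)) = (\<Sum>p\<in>{a..<int r}. 1)"
    by (rule sum.cong) (use False b in \<open>auto intro!: inner\<close>)
  also have "(\<Sum>p\<in>{int r..b}. run_sign r (nat \<bar>p\<bar>)) = (\<Sum>p\<in>{int r..b}. - 1)"
    by (intro sum.cong refl outer) auto
  finally have pos: "0 < (\<Sum>p\<in>{p \<in> {a..b}. 0 \<le> \<bar>p\<bar>}. run_sign r (nat \<bar>p\<bar>))"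
    using False b by simp
  show ?thesis
    using \<tau> neg pos by (metis mult_1 mult_minus_left neg_less_0_iff_less)
qed

text \<open>Outer sums depend on absolute values only, so a window may be reflected in the origin.\<close>

lemma window_changes_sign:
  assumes r: "3 \<le> r" and b: "b = a + 2 * int r - 1" "- int (radius r) \<le> a" "b \<le> int (radius r)"
    and \<tau>: "\<tau> = 1 \<or> \<tau> = (- 1 :: int)"
  shows "\<exists>t. \<tau> * (\<Sum>p\<in>{p \<in> {a..b}. t \<le> \<bar>p\<bar>}. run_sign r (nat \<bar>p\<bar>)) < 0"
proof (cases "- a \<le> b")
  case True
  then show ?thesis
    using window_changes_sign_nearer_right[OF r b(1) _ b(3) \<tau>] by blast
next
  case False
  obtain t where t: "\<tau> * (\<Sum>p\<in>{p \<in> {- b..- a}. t \<le> \<bar>p\<bar>}. run_sign r (nat \<bar>p\<bar>)) < 0"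
    using window_changes_sign_nearer_right[OF r, of "- a" "- b" \<tau>] False b \<tau> by auto
  have "(\<Sum>p\<in>{p \<in> {- b..- a}. t \<le> \<bar>p\<bar>}. run_sign r (nat \<bar>p\<bar>))
      = (\<Sum>p\<in>{p \<in> {a..b}. t \<le> \<bar>p\<bar>}. run_sign r (nat \<bar>p\<bar>))"
    by (rule sum.reindex_bij_witness[of _ uminus uminus]) auto
  with t show ?thesis by auto
qed

section \<open>The permutation\<close>

definition entry :: "nat \<Rightarrow> int \<Rightarrow> int" where
  "entry r p = run_sign r (nat \<bar>p\<bar>) * p"

text \<open>Equal entries have equal absolute values, hence sit at equal or opposite positions; opposite positions
  carry the same sign and so have opposite entries.\<close>

lemma inj_entry: "inj (entry r)"
proof (rule injI)
  fix p q assume eq: "entry r p = entry r q"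
  then have "\<bar>p\<bar> = \<bar>q\<bar>"
    using run_sign_cases[of r "nat \<bar>p\<bar>"] run_sign_cases[of r "nat \<bar>q\<bar>"]
    unfolding entry_def by auto
  with eq show "p = q"
    using run_sign_cases[of r "nat \<bar>p\<bar>"] unfolding entry_def by auto
qed

text \<open>The value further from 0 decides a comparison, and by \<open>p < q\<close> the outer position is \<open>q > 0\<close>
  or \<open>p < 0\<close>; in both cases sign \<open>1\<close> puts its value on the side that makes the pair
  increasing.\<close>

lemma entry_less_iff:
  assumes "p < q"
  shows "entry r p < entry r q \<longleftrightarrow> run_sign r (nat (max \<bar>p\<bar> \<bar>q\<bar>)) = 1"
proof -
  consider "\<bar>p\<bar> < \<bar>q\<bar>" "0 < q" | "\<bar>q\<bar> < \<bar>p\<bar>" "p < 0" | "q = - p" "0 < q"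
    using assms by linarith
  then show ?thesis
    using run_sign_cases[of r "nat \<bar>p\<bar>"] run_sign_cases[of r "nat \<bar>q\<bar>"]
    unfolding entry_def by cases (auto simp: max_def)
qed

text \<open>List index \<open>i\<close> stands for position \<open>i - radius r\<close>; a list of length \<open>2 * radius r + 1\<close>
  reaches the right end of the construction.\<close>

definition prefix_perm :: "nat \<Rightarrow> nat \<Rightarrow> int list" where
  "prefix_perm r n = map (\<lambda>i. entry r (int i - int (radius r))) [0..<n]"

lemma distinct_prefix_perm: "distinct (prefix_perm r n)"
  unfolding prefix_perm_def
  by (auto simp: distinct_map inj_on_def dest: injD[OF inj_entry])

lemma nths_single: "i < length xs \<Longrightarrow> nths xs {i} = [xs ! i]"
proof (induction xs arbitrary: i)
  case (Cons x xs)
  then show ?case by (cases i) (simp_all add: nths_Cons)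
qed simp

lemma nths_pair:
  assumes "i < j" "j < length xs"
  shows "nths xs {i, j} = [xs ! i, xs ! j]"
  using assms
proof (induction xs arbitrary: i j)
  case (Cons x xs)
  obtain j' where j: "j = Suc j'" using Cons.prems by (cases j) auto
  show ?case
  proof (cases i)
    case 0
    then show ?thesis using Cons.prems j by (simp add: nths_Cons nths_single)
  next
    case (Suc i')
    then have "{k. Suc k \<in> {i, j}} = {i', j'}" using j by auto
    with Suc j Cons show ?thesis by (simp add: nths_Cons)
  qed
qed simp

text \<open>
  Similarity makes all pairs of the twins increasing or all decreasing, recorded by \<open>\<tau> = 1\<close> or
  \<open>\<tau> = - 1\<close>. In either case the outer element of each pair has sign \<open>\<tau>\<close>, so the signs multiplied by
  \<open>\<tau>\<close> have nonnegative outer sums over the window, which contradicts the choice of the signs.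
\<close>

lemma no_tight_twins:
  assumes r: "3 \<le> r" and n: "n \<le> 2 * radius r + 1"
  shows "\<not> tight_twins r 2 (prefix_perm r n) \<P>"
proof
  assume tw: "tight_twins r 2 (prefix_perm r n) \<P>"
  define xs where "xs = prefix_perm r n"
  have len: "length xs = n"
    by (simp add: xs_def prefix_perm_def)
  from tw obtain s where fin: "finite \<P>" and card: "card \<P> = r"
    and sub: "\<And>P. P \<in> \<P> \<Longrightarrow> P \<subseteq> {..<n} \<and> card P = 2"
    and disj: "pairwise disjnt \<P>"
    and sim: "pairwise (\<lambda>P Q. similar (nths xs P) (nths xs Q)) \<P>"
    and s: "s + r * 2 \<le> n" "\<Union>\<P> = {s..<s + r * 2}"
    unfolding tight_twins_def xs_def[symmetric] len by blast
  \<comment> \<open>from list indices to positions relative to the centre\<close>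
  define c where "c i = int i - int (radius r)" for i
  define up where "up P \<longleftrightarrow> nths xs P ! 0 < nths xs P ! 1" for P
  have pair: "\<exists>i j. P = {i, j} \<and> i < j \<and> j < n \<and>
      (up P \<longleftrightarrow> run_sign r (nat (max \<bar>c i\<bar> \<bar>c j\<bar>)) = 1) \<and> length (nths xs P) = 2"
    if P: "P \<in> \<P>" for P
  proof -
    obtain i j where "P = {i, j}" "i \<noteq> j"
      using sub[OF P] by (auto simp: card_2_iff)
    then obtain i j where ij: "P = {i, j}" "i < j"
      by (metis insert_commute nat_neq_iff)
    then have "j < n" using sub[OF P] by auto
    have nths: "nths xs P = [xs ! i, xs ! j]"
      using nths_pair[of i j xs] ij \<open>j < n\<close> len by simp
    have "xs ! i = entry r (c i)" "xs ! j = entry r (c j)"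
      using ij \<open>j < n\<close> by (simp_all add: xs_def prefix_perm_def c_def)
    then have "up P \<longleftrightarrow> run_sign r (nat (max \<bar>c i\<bar> \<bar>c j\<bar>)) = 1"
      using entry_less_iff[of "c i" "c j" r] ij(2) unfolding up_def nths by (simp add: c_def)
    then show ?thesis using ij \<open>j < n\<close> nths by auto
  qed
  have same: "up P = up Q" if "P \<in> \<P>" "Q \<in> \<P>" for P Q
  proof (cases "P = Q")
    case False
    then have "similar (nths xs P) (nths xs Q)"
      using sim that by (auto simp: pairwise_def)
    then show ?thesis
      using pair[OF that(1)] by (auto simp: similar_def up_def)
  qed simp
  obtain P0 where "P0 \<in> \<P>"
    using card r by (metis card.empty ex_in_conv not_numeral_le_zero)
  define \<tau> :: int where "\<tau> = (if up P0 then 1 else - 1)"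
  have \<tau>: "\<tau> = 1 \<or> \<tau> = - 1" by (simp add: \<tau>_def)
  have outer: "\<tau> * run_sign r (nat (max \<bar>c i\<bar> \<bar>c j\<bar>)) = 1"
    if "P \<in> \<P>" "P = {i, j}" for P i j
  proof -
    from pair[OF that(1)] obtain i' j'
      where ij: "P = {i', j'}" "up P \<longleftrightarrow> run_sign r (nat (max \<bar>c i'\<bar> \<bar>c j'\<bar>)) = 1"
      by blast
    then have "max \<bar>c i'\<bar> \<bar>c j'\<bar> = max \<bar>c i\<bar> \<bar>c j\<bar>"
      using that(2) by (metis doubleton_eq_iff max.commute)
    then show ?thesis
      using ij(2) same[OF that(1) \<open>P0 \<in> \<P>\<close>]
        run_sign_cases[of r "nat (max \<bar>c i\<bar> \<bar>c j\<bar>)"] by (auto simp: \<tau>_def)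
  qed
  define a where "a = c s"
  define b where "b = a + 2 * int r - 1"
  define \<Q> where "\<Q> = (`) c ` \<P>"
  have inj_c: "inj c" by (auto simp: inj_def c_def)
  have Un: "\<Union>\<Q> = {a..b}"
  proof -
    have "\<Union>\<Q> = c ` {s..<s + r * 2}"
      unfolding \<Q>_def s(2)[symmetric] by blast
    also have "\<dots> = {a..b}"
    proof
      show "{a..b} \<subseteq> c ` {s..<s + r * 2}"
      proof
        fix x assume "x \<in> {a..b}"
        then show "x \<in> c ` {s..<s + r * 2}"
          by (intro image_eqI[of _ _ "nat (x + int (radius r))"]) (auto simp: a_def b_def c_def)
      qed
    qed (auto simp: a_def b_def c_def)
    finally show ?thesis .
  qed
  have "0 \<le> (\<Sum>p\<in>{p \<in> \<Union>\<Q>. t \<le> \<bar>p\<bar>}. \<tau> * run_sign r (nat \<bar>p\<bar>))" for t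
  proof (rule sum_outer_nonneg)
    show "finite \<Q>" using fin by (simp add: \<Q>_def)
    show "pairwise disjnt \<Q>"
      using disj inj_c unfolding \<Q>_def pairwise_def disjnt_def
      by (auto simp: image_Int[symmetric])
    fix Q assume "Q \<in> \<Q>"
    then obtain P where P: "P \<in> \<P>" "Q = c ` P" by (auto simp: \<Q>_def)
    obtain i j where ij: "P = {i, j}" "\<bar>c j\<bar> \<le> \<bar>c i\<bar>" "i \<noteq> j"
      using pair[OF P(1)] by (metis insert_commute linorder_le_cases nat_neq_iff)
    have "\<tau> * run_sign r (nat \<bar>c i\<bar>) = 1"
      using outer[OF P(1) ij(1)] ij(2) by (simp add: max_def)
    moreover have "\<tau> * run_sign r (nat \<bar>c j\<bar>) \<ge> - 1"
      using \<tau> run_sign_cases[of r "nat \<bar>c j\<bar>"] by auto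
    ultimately show "\<exists>p q. Q = {p, q} \<and> p \<noteq> q \<and> \<bar>q\<bar> \<le> \<bar>p\<bar> \<and> \<tau> * run_sign r (nat \<bar>p\<bar>) = 1
        \<and> \<tau> * run_sign r (nat \<bar>q\<bar>) \<ge> - 1"
      using P(2) ij injD[OF inj_c, of i j]
      by (intro exI[of _ "c i"] exI[of _ "c j"]) auto
  qed
  moreover have "\<exists>t. \<tau> * (\<Sum>p\<in>{p \<in> {a..b}. t \<le> \<bar>p\<bar>}. run_sign r (nat \<bar>p\<bar>)) < 0"
    using s(1) n \<tau> by (intro window_changes_sign[OF r]) (auto simp: a_def b_def c_def)
  ultimately show False
    by (simp add: Un sum_distrib_left flip: not_le)
qed

lemma radius_eq:
  assumes "3 \<le> r"
  shows "2 * radius r + 1 = r * (r + 5) - 13"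
proof -
  have "2 * (r * (r + 1) div 2) = r * (r + 1)" by simp
  with assms show ?thesis
    by (simp add: radius_def algebra_simps)
qed

theorem proposition4p5:
  fixes r :: nat
  assumes "r \<ge> 3"
  shows "f r 2 \<ge> enat (r * (r + 5) - 12)"
  unfolding f_def
proof (rule INF_greatest)
  fix n
  assume "n \<in> {n. \<forall>xs. is_permutation xs \<and> length xs = n \<longrightarrow> (\<exists>\<P>. tight_twins r 2 xs \<P>)}"
  then have "\<exists>\<P>. tight_twins r 2 (prefix_perm r n) \<P>"
    using distinct_prefix_perm[of r n] by (simp add: is_permutation_def prefix_perm_def)
  then have "\<not> n \<le> r * (r + 5) - 13"
    using no_tight_twins[OF assms] radius_eq[OF assms] by metis
  then show "enat (r * (r + 5) - 12) \<le> enat n" by simp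
qed

end
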